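(* Let $T$ be a ternary $\Gamma$-semiring. For every set $S$, the free semimodule $F(S)$ is projective in $\mathsf{SMod}_{T,\Gamma}$.
   Context: Fix a commutative monoid $(\Gamma,+,0_\Gamma)$. A ternary $\Gamma$-semiring is a commutative monoid $(T,+,0)$ with a map $T\times\Gamma\times T\times\Gamma\times T\to T$, $(a,\alpha,b,\beta,c)\mapsto a\alpha b\beta c$, that is additive in each of the five slots separately, satisfies ternary associativity $(a\alpha b\beta c)\gamma d\delta e=a\alpha(b\beta c\gamma d)\delta e=a\alpha b\beta(c\gamma d\delta e)$ for all $a,b,c,d,e\in T$, $\alpha,\beta,\gamma,\delta\in\Gamma$, and satisfies $a\alpha b\beta c=0$ whenever one of $a,b,c$ is $0$ or one of $\alpha,\beta$ is $0_\Gamma$. A ternary $\Gamma$-semimodule over $T$ is a commutative monoid $(M,+,0)$ with a map $T\times\Gamma\times M\times\Gamma\times T\to M$, $(a,\alpha,m,\beta,b)\mapsto a\alpha m\beta b$, that is additive in each of the five slots separately, satisfies $a\alpha m\beta b=0$ whenever $a=0$ or $m=0$ or $b=0$ or $\alpha=0_\Gamma$ or $\beta=0_\Gamma$, and satisfies the compatibility law $(a\alpha b\beta c)\gamma m\delta d=a\alpha(b\beta m\gamma c)\delta d$ for all $a,b,c,d\in T$, $m\in M$, $\alpha,\beta,\gamma,\delta\in\Gamma$. A morphism $f:M\to N$ is a monoid morphism with $f(a\alpha m\beta b)=a\alpha f(m)\beta b$ for all $a,b\in T$, $\alpha,\beta\in\Gamma$, $m\in M$. The resulting category is $\mathsf{SMod}_{T,\Gamma}$.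 Construction of $F(S)$. The set $\mathsf{Term}_S$ of terms is defined inductively: each $s\in S$ gives a term $\mathbf{s}$; there is a constant term $\mathbf{0}$; if $t,u$ are terms then $(t\oplus u)$ is a term; if $t$ is a term and $(a,\alpha,\beta,b)\in T\times\Gamma\times\Gamma\times T$ then $(a\alpha\,t\,\beta b)$ is a term. Let $\equiv$ be the smallest equivalence relation on $\mathsf{Term}_S$ that is stable under $\oplus$ and under every operator $t\mapsto a\alpha\,t\,\beta b$ and that contains all instances of the identities making $(\mathsf{Term}_S,\oplus,\mathbf{0})$ a commutative monoid and making the operators $t\mapsto a\alpha\,t\,\beta b$ satisfy the semimodule axioms above (additivity in each of the five slots, zero stability, compatibility with ternary multiplication). Put $F(S):=\mathsf{Term}_S/{\equiv}$ with the induced operations; it is a ternary $\Gamma$-semimodule. A regular epimorphism is a morphism that is a coequalizer of some parallel pair. An object $P$ is projective if for every regular epimorphism $e:X\to Y$ and every morphism $f:P\to Y$ there exists a morphism $\tilde f:P\to X$ with $e\circ\tilde f=f$. *)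

theory Defs
  imports "HOL-Algebra.Group"
begin

text \<open>The commutative monoids \<open>\<Gamma>\<close> and \<open>T\<close>, which stay fixed throughout, are types of class
  \<^class>\<open>comm_monoid_add\<close>; \<open>tmul a \<alpha> b \<beta> c\<close> stands for \<open>a \<alpha> b \<beta> c\<close>.\<close>

locale ternary_gamma_semiring =
  fixes tmul :: "'t::comm_monoid_add \<Rightarrow> 'g::comm_monoid_add \<Rightarrow> 't \<Rightarrow> 'g \<Rightarrow> 't \<Rightarrow> 't"
  assumes tmul_add1: "tmul (a + a') \<alpha> b \<beta> c = tmul a \<alpha> b \<beta> c + tmul a' \<alpha> b \<beta> c"
    and tmul_add2: "tmul a (\<alpha> + \<alpha>') b \<beta> c = tmul a \<alpha> b \<beta> c + tmul a \<alpha>' b \<beta> c"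
    and tmul_add3: "tmul a \<alpha> (b + b') \<beta> c = tmul a \<alpha> b \<beta> c + tmul a \<alpha> b' \<beta> c"
    and tmul_add4: "tmul a \<alpha> b (\<beta> + \<beta>') c = tmul a \<alpha> b \<beta> c + tmul a \<alpha> b \<beta>' c"
    and tmul_add5: "tmul a \<alpha> b \<beta> (c + c') = tmul a \<alpha> b \<beta> c + tmul a \<alpha> b \<beta> c'"
    and tmul_assoc1: "tmul (tmul a \<alpha> b \<beta> c) \<gamma> d \<delta> e = tmul a \<alpha> (tmul b \<beta> c \<gamma> d) \<delta> e"
    and tmul_assoc2: "tmul a \<alpha> (tmul b \<beta> c \<gamma> d) \<delta> e = tmul a \<alpha> b \<beta> (tmul c \<gamma> d \<delta> e)"
    and tmul_zero1: "tmul 0 \<alpha> b \<beta> c = 0"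
    and tmul_zero2: "tmul a 0 b \<beta> c = 0"
    and tmul_zero3: "tmul a \<alpha> 0 \<beta> c = 0"
    and tmul_zero4: "tmul a \<alpha> b 0 c = 0"
    and tmul_zero5: "tmul a \<alpha> b \<beta> 0 = 0"

text \<open>The category has semimodules on arbitrary underlying sets as objects, so these have explicit
  carriers.  The record reuses the monoid structures of HOL-Algebra: although written \<open>\<otimes>\<close> and \<open>\<one>\<close>,
  the monoid structure is the addition and the zero of the semimodule.\<close>

record ('t, 'g, 'm) semimod = "'m monoid" +
  act :: "'t \<Rightarrow> 'g \<Rightarrow> 'm \<Rightarrow> 'g \<Rightarrow> 't \<Rightarrow> 'm"

locale ternary_gamma_semimodule = ternary_gamma_semiring tmul + comm_monoid M
  for tmul :: "'t::comm_monoid_add \<Rightarrow> 'g::comm_monoid_add \<Rightarrow> 't \<Rightarrow> 'g \<Rightarrow> 't \<Rightarrow> 't"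
    and M :: "('t, 'g, 'm) semimod" (structure) +
  assumes act_closed: "m \<in> carrier M \<Longrightarrow> act M a \<alpha> m \<beta> b \<in> carrier M"
    and act_add1: "m \<in> carrier M \<Longrightarrow>
      act M (a + a') \<alpha> m \<beta> b = act M a \<alpha> m \<beta> b \<otimes> act M a' \<alpha> m \<beta> b"
    and act_add2: "m \<in> carrier M \<Longrightarrow>
      act M a (\<alpha> + \<alpha>') m \<beta> b = act M a \<alpha> m \<beta> b \<otimes> act M a \<alpha>' m \<beta> b"
    and act_add3: "m \<in> carrier M \<Longrightarrow> m' \<in> carrier M \<Longrightarrow>
      act M a \<alpha> (m \<otimes> m') \<beta> b = act M a \<alpha> m \<beta> b \<otimes> act M a \<alpha> m' \<beta> b"
    and act_add4: "m \<in> carrier M \<Longrightarrow>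
      act M a \<alpha> m (\<beta> + \<beta>') b = act M a \<alpha> m \<beta> b \<otimes> act M a \<alpha> m \<beta>' b"
    and act_add5: "m \<in> carrier M \<Longrightarrow>
      act M a \<alpha> m \<beta> (b + b') = act M a \<alpha> m \<beta> b \<otimes> act M a \<alpha> m \<beta> b'"
    and act_zero1: "m \<in> carrier M \<Longrightarrow> act M 0 \<alpha> m \<beta> b = \<one>"
    and act_zero2: "m \<in> carrier M \<Longrightarrow> act M a 0 m \<beta> b = \<one>"
    and act_zero3: "act M a \<alpha> \<one> \<beta> b = \<one>"
    and act_zero4: "m \<in> carrier M \<Longrightarrow> act M a \<alpha> m 0 b = \<one>"
    and act_zero5: "m \<in> carrier M \<Longrightarrow> act M a \<alpha> m \<beta> 0 = \<one>"
    and act_compat: "m \<in> carrier M \<Longrightarrow>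
      act M (tmul a \<alpha> b \<beta> c) \<gamma> m \<delta> d = act M a \<alpha> (act M b \<beta> m \<gamma> c) \<delta> d"

text \<open>Morphisms are extensional functions (\<^const>\<open>undefined\<close> outside the carrier), so that equality
  of morphisms is equality of functions; they are composed with \<^const>\<open>compose\<close>.\<close>

definition mor :: "('t, 'g, 'm) semimod \<Rightarrow> ('t, 'g, 'n) semimod \<Rightarrow> ('m \<Rightarrow> 'n) set" where
  "mor M N = {f \<in> hom M N. f \<in> extensional (carrier M) \<and> f \<one>\<^bsub>M\<^esub> = \<one>\<^bsub>N\<^esub> \<and>
     (\<forall>a \<alpha> \<beta> b. \<forall>m \<in> carrier M. f (act M a \<alpha> m \<beta> b) = act N a \<alpha> (f m) \<beta> b)}"

definition coequalizer ::
  "('t::comm_monoid_add \<Rightarrow> 'g::comm_monoid_add \<Rightarrow> 't \<Rightarrow> 'g \<Rightarrow> 't \<Rightarrow> 't) \<Rightarrow>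
   ('t, 'g, 'u) semimod \<Rightarrow> ('t, 'g, 'u) semimod \<Rightarrow> ('u \<Rightarrow> 'u) \<Rightarrow> ('u \<Rightarrow> 'u) \<Rightarrow>
   ('t, 'g, 'u) semimod \<Rightarrow> ('u \<Rightarrow> 'u) \<Rightarrow> bool" where
  "coequalizer tmul A X f g Y e \<longleftrightarrow>
     e \<in> mor X Y \<and> compose (carrier A) e f = compose (carrier A) e g \<and>
     (\<forall>Z :: ('t, 'g, 'u) semimod. ternary_gamma_semimodule tmul Z \<longrightarrow>
       (\<forall>k \<in> mor X Z. compose (carrier A) k f = compose (carrier A) k g \<longrightarrow>
         (\<exists>!h. h \<in> mor Y Z \<and> compose (carrier X) h e = k)))"

definition regular_epi ::
  "('t::comm_monoid_add \<Rightarrow> 'g::comm_monoid_add \<Rightarrow> 't \<Rightarrow> 'g \<Rightarrow> 't \<Rightarrow> 't) \<Rightarrow>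
   ('t, 'g, 'u) semimod \<Rightarrow> ('t, 'g, 'u) semimod \<Rightarrow> ('u \<Rightarrow> 'u) \<Rightarrow> bool" where
  "regular_epi tmul X Y e \<longleftrightarrow>
     ternary_gamma_semimodule tmul X \<and> ternary_gamma_semimodule tmul Y \<and>
     (\<exists>(A :: ('t, 'g, 'u) semimod) f g. ternary_gamma_semimodule tmul A \<and>
        f \<in> mor A X \<and> g \<in> mor A X \<and> coequalizer tmul A X f g Y e)"

text \<open>The type \<open>'u\<close> plays the role of the universe: the objects \<open>X\<close>, \<open>Y\<close> (and the objects over which
  \<^const>\<open>regular_epi\<close> and \<^const>\<open>coequalizer\<close> quantify) are the semimodules whose carrier is a set of
  elements of \<open>'u\<close>.  HOL has no quantification over types inside formulas, so \<open>'u\<close> is a parameter of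
  projectivity, meant to be left arbitrary.  The object \<open>P\<close> may live in another type.\<close>

definition projective ::
  "'u itself \<Rightarrow> ('t::comm_monoid_add \<Rightarrow> 'g::comm_monoid_add \<Rightarrow> 't \<Rightarrow> 'g \<Rightarrow> 't \<Rightarrow> 't) \<Rightarrow>
   ('t, 'g, 'p) semimod \<Rightarrow> bool" where
  "projective (_ :: 'u itself) tmul P \<longleftrightarrow>
     ternary_gamma_semimodule tmul P \<and>
     (\<forall>(X :: ('t, 'g, 'u) semimod) (Y :: ('t, 'g, 'u) semimod) e.
        regular_epi tmul X Y e \<longrightarrow>
        (\<forall>f \<in> mor P Y. \<exists>f' \<in> mor P X. compose (carrier P) e f' = f))"

datatype ('t, 'g, 's) trm =
    Gen 's
  | Zero
  | Plus "('t, 'g, 's) trm" "('t, 'g, 's) trm"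
  | Op 't 'g "('t, 'g, 's) trm" 'g 't

text \<open>\<open>S\<close> is a set rather than a type because it may be empty.\<close>

inductive_set Term :: "'s set \<Rightarrow> ('t, 'g, 's) trm set" for S :: "'s set" where
  Gen: "s \<in> S \<Longrightarrow> Gen s \<in> Term S"
| Zero: "Zero \<in> Term S"
| Plus: "t \<in> Term S \<Longrightarrow> u \<in> Term S \<Longrightarrow> Plus t u \<in> Term S"
| Op: "t \<in> Term S \<Longrightarrow> Op a \<alpha> t \<beta> b \<in> Term S"

inductive_set term_eq ::
  "('t::comm_monoid_add \<Rightarrow> 'g::comm_monoid_add \<Rightarrow> 't \<Rightarrow> 'g \<Rightarrow> 't \<Rightarrow> 't) \<Rightarrow> 's set \<Rightarrow>
   (('t, 'g, 's) trm \<times> ('t, 'g, 's) trm) set"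
  for tmul :: "'t::comm_monoid_add \<Rightarrow> 'g::comm_monoid_add \<Rightarrow> 't \<Rightarrow> 'g \<Rightarrow> 't \<Rightarrow> 't" and S :: "'s set"
where
  refl: "t \<in> Term S \<Longrightarrow> (t, t) \<in> term_eq tmul S"
| sym: "(t, u) \<in> term_eq tmul S \<Longrightarrow> (u, t) \<in> term_eq tmul S"
| trans: "(t, u) \<in> term_eq tmul S \<Longrightarrow> (u, v) \<in> term_eq tmul S \<Longrightarrow> (t, v) \<in> term_eq tmul S"
| Plus_cong: "(t, t') \<in> term_eq tmul S \<Longrightarrow> (u, u') \<in> term_eq tmul S \<Longrightarrow>
    (Plus t u, Plus t' u') \<in> term_eq tmul S"
| Op_cong: "(t, t') \<in> term_eq tmul S \<Longrightarrow> (Op a \<alpha> t \<beta> b, Op a \<alpha> t' \<beta> b) \<in> term_eq tmul S"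
| Plus_assoc: "t \<in> Term S \<Longrightarrow> u \<in> Term S \<Longrightarrow> v \<in> Term S \<Longrightarrow>
    (Plus (Plus t u) v, Plus t (Plus u v)) \<in> term_eq tmul S"
| Plus_comm: "t \<in> Term S \<Longrightarrow> u \<in> Term S \<Longrightarrow> (Plus t u, Plus u t) \<in> term_eq tmul S"
| Plus_Zero: "t \<in> Term S \<Longrightarrow> (Plus t Zero, t) \<in> term_eq tmul S"
| Op_add1: "t \<in> Term S \<Longrightarrow>
    (Op (a + a') \<alpha> t \<beta> b, Plus (Op a \<alpha> t \<beta> b) (Op a' \<alpha> t \<beta> b)) \<in> term_eq tmul S"
| Op_add2: "t \<in> Term S \<Longrightarrow>
    (Op a (\<alpha> + \<alpha>') t \<beta> b, Plus (Op a \<alpha> t \<beta> b) (Op a \<alpha>' t \<beta> b)) \<in> term_eq tmul S"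
| Op_add3: "t \<in> Term S \<Longrightarrow> u \<in> Term S \<Longrightarrow>
    (Op a \<alpha> (Plus t u) \<beta> b, Plus (Op a \<alpha> t \<beta> b) (Op a \<alpha> u \<beta> b)) \<in> term_eq tmul S"
| Op_add4: "t \<in> Term S \<Longrightarrow>
    (Op a \<alpha> t (\<beta> + \<beta>') b, Plus (Op a \<alpha> t \<beta> b) (Op a \<alpha> t \<beta>' b)) \<in> term_eq tmul S"
| Op_add5: "t \<in> Term S \<Longrightarrow>
    (Op a \<alpha> t \<beta> (b + b'), Plus (Op a \<alpha> t \<beta> b) (Op a \<alpha> t \<beta> b')) \<in> term_eq tmul S"
| Op_zero1: "t \<in> Term S \<Longrightarrow> (Op 0 \<alpha> t \<beta> b, Zero) \<in> term_eq tmul S"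
| Op_zero2: "t \<in> Term S \<Longrightarrow> (Op a 0 t \<beta> b, Zero) \<in> term_eq tmul S"
| Op_zero3: "(Op a \<alpha> Zero \<beta> b, Zero) \<in> term_eq tmul S"
| Op_zero4: "t \<in> Term S \<Longrightarrow> (Op a \<alpha> t 0 b, Zero) \<in> term_eq tmul S"
| Op_zero5: "t \<in> Term S \<Longrightarrow> (Op a \<alpha> t \<beta> 0, Zero) \<in> term_eq tmul S"
| Op_compat: "t \<in> Term S \<Longrightarrow>
    (Op (tmul a \<alpha> b \<beta> c) \<gamma> t \<delta> d, Op a \<alpha> (Op b \<beta> t \<gamma> c) \<delta> d) \<in> term_eq tmul S"

text \<open>The induced operations on equivalence classes, written as unions over all representatives.\<close>

definition free_semimod ::
  "('t::comm_monoid_add \<Rightarrow> 'g::comm_monoid_add \<Rightarrow> 't \<Rightarrow> 'g \<Rightarrow> 't \<Rightarrow> 't) \<Rightarrow> 's set \<Rightarrow>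
   ('t, 'g, ('t, 'g, 's) trm set) semimod" where
  "free_semimod tmul S =
     \<lparr> carrier = Term S // term_eq tmul S,
       mult = (\<lambda>C D. \<Union>t\<in>C. \<Union>u\<in>D. term_eq tmul S `` {Plus t u}),
       one = term_eq tmul S `` {Zero},
       act = (\<lambda>a \<alpha> C \<beta> b. \<Union>t\<in>C. term_eq tmul S `` {Op a \<alpha> t \<beta> b}) \<rparr>"

end

theory Submission
  imports Defs
begin

text \<open>A regular epimorphism \<open>e\<close> is surjective: its image is a subsemimodule \<open>I\<close> of the codomain \<open>Y\<close>,
  so the universal property factors \<open>e\<close>, corestricted to \<open>I\<close>, through \<open>e\<close> itself; composing the
  factorization with the inclusion gives an endomorphism \<open>h\<close> of \<open>Y\<close> with \<open>h \<circ> e = e\<close>, and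
  \<open>h = id\<close> by uniqueness, whence \<open>Y = I\<close>.  A morphism out of \<open>F(S)\<close> is therefore lifted along \<open>e\<close>
  by choosing preimages of the images of the generators.\<close>

lemma morI:
  assumes "\<And>x. x \<in> carrier M \<Longrightarrow> f x \<in> carrier N"
    and "\<And>x y. x \<in> carrier M \<Longrightarrow> y \<in> carrier M \<Longrightarrow> f (x \<otimes>\<^bsub>M\<^esub> y) = f x \<otimes>\<^bsub>N\<^esub> f y"
    and "f \<in> extensional (carrier M)"
    and "f \<one>\<^bsub>M\<^esub> = \<one>\<^bsub>N\<^esub>"
    and "\<And>a \<alpha> x \<beta> b. x \<in> carrier M \<Longrightarrow> f (act M a \<alpha> x \<beta> b) = act N a \<alpha> (f x) \<beta> b"
  shows "f \<in> mor M N"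
  using assms by (auto simp: mor_def hom_def)

lemma
  assumes "f \<in> mor M N"
  shows mor_closed: "x \<in> carrier M \<Longrightarrow> f x \<in> carrier N"
    and mor_mult: "x \<in> carrier M \<Longrightarrow> y \<in> carrier M \<Longrightarrow> f (x \<otimes>\<^bsub>M\<^esub> y) = f x \<otimes>\<^bsub>N\<^esub> f y"
    and mor_extensional: "f \<in> extensional (carrier M)"
    and mor_one: "f \<one>\<^bsub>M\<^esub> = \<one>\<^bsub>N\<^esub>"
    and mor_act: "x \<in> carrier M \<Longrightarrow> f (act M a \<alpha> x \<beta> b) = act N a \<alpha> (f x) \<beta> b"
  using assms by (auto simp: mor_def hom_def)

lemma mor_compose:
  assumes "ternary_gamma_semimodule tmul L" "f \<in> mor L M" "g \<in> mor M N"
  shows "compose (carrier L) g f \<in> mor L N"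
proof -
  interpret L: ternary_gamma_semimodule tmul L by fact
  show ?thesis
    by (rule morI)
      (use assms(2,3) in \<open>simp_all add: compose_def mor_closed mor_mult mor_one mor_act L.act_closed\<close>)
qed

lemma mor_id:
  assumes "ternary_gamma_semimodule tmul M"
  shows "restrict id (carrier M) \<in> mor M M"
proof -
  interpret ternary_gamma_semimodule tmul M by fact
  show ?thesis by (rule morI) (simp_all add: act_closed)
qed

text \<open>The operations are still those of \<open>Y\<close>, so the equational axioms are
  inherited. What remains is closure: since \<open>e\<close> preserves sums, zero and actions,
  results on images are images of results in \<open>X\<close>.\<close>

lemma image_semimodule:
  assumes X: "ternary_gamma_semimodule tmul X" and Y: "ternary_gamma_semimodule tmul Y"
    and e: "e \<in> mor X Y"
  shows "ternary_gamma_semimodule tmul (Y\<lparr>carrier := e ` carrier X\<rparr>)"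
proof -
  interpret X: ternary_gamma_semimodule tmul X by fact
  interpret Y: ternary_gamma_semimodule tmul Y by fact
  have sub: "e x \<in> carrier Y" if "x \<in> carrier X" for x
    using mor_closed[OF e that] .
  have mult: "e x \<otimes>\<^bsub>Y\<^esub> e y \<in> e ` carrier X" if "x \<in> carrier X" "y \<in> carrier X" for x y
    using mor_mult[OF e that] that by (metis X.m_closed imageI)
  have one: "\<one>\<^bsub>Y\<^esub> \<in> e ` carrier X"
    using mor_one[OF e] by (metis X.one_closed imageI)
  have act: "act Y a \<alpha> (e x) \<beta> b \<in> e ` carrier X" if "x \<in> carrier X" for a \<alpha> x \<beta> b
    using mor_act[OF e that] that by (metis X.act_closed imageI)
  show ?thesis
    by unfold_locales
      (auto simp: mult one act sub Y.m_ac Y.act_add1 Y.act_add2 Y.act_add3 Y.act_add4 Y.act_add5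
        Y.act_zero1 Y.act_zero2 Y.act_zero3 Y.act_zero4 Y.act_zero5 Y.act_compat)
qed

lemma regular_epi_surj:
  assumes "regular_epi tmul X Y e"
  shows "e ` carrier X = carrier Y"
proof -
  obtain A f g where X: "ternary_gamma_semimodule tmul X" and Y: "ternary_gamma_semimodule tmul Y"
    and coeq: "coequalizer tmul A X f g Y e"
    using assms unfolding regular_epi_def by blast
  have e: "e \<in> mor X Y" and fg: "compose (carrier A) e f = compose (carrier A) e g"
    using coeq by (auto simp: coequalizer_def)
  \<comment> \<open>The test morphism is \<open>e\<close> itself with codomain \<open>Z\<close>; it
    identifies \<open>f\<close> and \<open>g\<close> by \<open>fg\<close>, which does not mention
    the codomain.\<close>
  have univ: "\<exists>!h. h \<in> mor Y Z \<and> compose (carrier X) h e = e"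
    if "ternary_gamma_semimodule tmul Z" "e \<in> mor X Z" for Z
    using coeq that fg unfolding coequalizer_def by blast
  \<comment> \<open>The image keeps the element type of \<open>Y\<close>, so it is among the objects
    over which the universal property quantifies.\<close>
  let ?I = "Y\<lparr>carrier := e ` carrier X\<rparr>"
  have "e \<in> mor X ?I"
    using e by (auto simp: mor_def hom_def)
  then obtain h where h: "h \<in> mor Y ?I" "compose (carrier X) h e = e"
    using univ[OF image_semimodule[OF X Y e]] by blast
  have "e ` carrier X \<subseteq> carrier Y"
    using mor_closed[OF e] by blast
  then have hY: "h \<in> mor Y Y"
    using h(1) by (fastforce simp: mor_def hom_def)
  \<comment> \<open>The identity is a second factorization of \<open>e\<close> through
    \<open>e\<close>, to be compared with \<open>h\<close>. Extensionality of \<open>e\<close> gives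
    the equality outside \<open>carrier X\<close>.\<close>
  have "compose (carrier X) (restrict id (carrier Y)) e = e"
    using mor_closed[OF e] mor_extensional[OF e] by (auto simp: compose_def fun_eq_iff extensional_def)
  then have "h = restrict id (carrier Y)"
    using univ[OF Y e] hY h(2) mor_id[OF Y] by blast
  then have "carrier Y \<subseteq> e ` carrier X"
    using mor_closed[OF h(1)] by auto
  with \<open>e ` carrier X \<subseteq> carrier Y\<close> show ?thesis by blast
qed

lemma term_eq_Term:
  "(t, u) \<in> term_eq tmul S \<Longrightarrow> t \<in> Term S \<and> u \<in> Term S"
  by (induction rule: term_eq.induct) (auto intro: Term.intros)

lemma equiv_term_eq: "equiv (Term S) (term_eq tmul S)"
proof (rule equivI)
  show "term_eq tmul S \<subseteq> Term S \<times> Term S"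
    by (auto dest: term_eq_Term)
  show "refl_on (Term S) (term_eq tmul S)"
    by (simp add: refl_on_def term_eq.refl)
  show "sym (term_eq tmul S)"
    by (rule symI) (rule term_eq.sym)
  show "trans (term_eq tmul S)"
    by (rule transI) (rule term_eq.trans)
qed

abbreviation term_class ::
  "('t::comm_monoid_add \<Rightarrow> 'g::comm_monoid_add \<Rightarrow> 't \<Rightarrow> 'g \<Rightarrow> 't \<Rightarrow> 't) \<Rightarrow> 's set \<Rightarrow>
   ('t, 'g, 's) trm \<Rightarrow> ('t, 'g, 's) trm set" where
  "term_class tmul S t \<equiv> term_eq tmul S `` {t}"

lemma term_class_eq: "(t, u) \<in> term_eq tmul S \<Longrightarrow> term_class tmul S t = term_class tmul S u"
  by (rule equiv_class_eq[OF equiv_term_eq])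

lemma carrier_free: "carrier (free_semimod tmul S) = term_class tmul S ` Term S"
  by (auto simp: free_semimod_def quotient_def)

lemma one_free: "\<one>\<^bsub>free_semimod tmul S\<^esub> = term_class tmul S Zero"
  by (simp add: free_semimod_def)

text \<open>Stability of \<open>term_eq\<close> under \<open>Plus\<close> makes all members of the
  union over representatives equal, so it collapses to the class obtained from any one
  choice.\<close>

lemma mult_free:
  assumes "t \<in> Term S" "u \<in> Term S"
  shows "term_class tmul S t \<otimes>\<^bsub>free_semimod tmul S\<^esub> term_class tmul S u =
    term_class tmul S (Plus t u)"
proof -
  have "congruent2 (term_eq tmul S) (term_eq tmul S) (\<lambda>t u. term_class tmul S (Plus t u))"
    by (auto simp: congruent2_def intro!: term_class_eq Plus_cong)
  from UN_equiv_class2[OF equiv_term_eq equiv_term_eq this assms] show ?thesis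
    by (simp add: free_semimod_def)
qed

lemma act_free:
  assumes "t \<in> Term S"
  shows "act (free_semimod tmul S) a \<alpha> (term_class tmul S t) \<beta> b = term_class tmul S (Op a \<alpha> t \<beta> b)"
proof -
  have "congruent (term_eq tmul S) (\<lambda>t. term_class tmul S (Op a \<alpha> t \<beta> b))"
    by (auto simp: congruent_def intro!: term_class_eq Op_cong)
  from UN_equiv_class[OF equiv_term_eq this assms] show ?thesis
    by (simp add: free_semimod_def)
qed

lemmas free_simps = carrier_free one_free mult_free act_free

lemma free_semimodule:
  assumes "ternary_gamma_semiring tmul"
  shows "ternary_gamma_semimodule tmul (free_semimod tmul S)"
proof -
  interpret ternary_gamma_semiring tmul by fact
  \<comment> \<open>Only the right unit law is a generating identity; the left one follows by
    commutativity.\<close>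
  have Zero_Plus: "(Plus Zero t, t) \<in> term_eq tmul S" if "t \<in> Term S" for t
    using that by (blast intro: term_eq.trans Plus_comm Plus_Zero Term.Zero)
  show ?thesis
    \<comment> \<open>On representatives, each remaining axiom is an instance of a generating
      identity, which are the rules from the sixth on. Deleting \<open>equalityI\<close> keeps
      equations between classes whole, so that \<open>term_class_eq\<close> applies.\<close>
    by unfold_locales
      (auto simp: free_simps Term.intros intro!: term_class_eq term_eq.intros(6-) Zero_Plus
        del: equalityI)
qed

text \<open>The generators generate: every element is the class of a term, and induction on the term
  uses that both morphisms preserve the operations.\<close>

lemma mor_free_eqI:
  assumes f: "f \<in> mor (free_semimod tmul S) N" and g: "g \<in> mor (free_semimod tmul S) N"
    and gen: "\<And>s. s \<in> S \<Longrightarrow> f (term_class tmul S (Gen s)) = g (term_class tmul S (Gen s))"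
  shows "f = g"
proof (rule extensionalityI)
  show "f \<in> extensional (carrier (free_semimod tmul S))"
    and "g \<in> extensional (carrier (free_semimod tmul S))"
    using f g by (auto dest: mor_extensional)
next
  fix C assume "C \<in> carrier (free_semimod tmul S)"
  then obtain t where t: "t \<in> Term S" "C = term_class tmul S t"
    by (auto simp: carrier_free)
  have "f (term_class tmul S t) = g (term_class tmul S t)"
    using t(1)
  proof induction
    case (Gen s)
    then show ?case by (rule gen)
  next
    case Zero
    then show ?case using mor_one[OF f] mor_one[OF g] by (simp add: one_free)
  next
    case (Plus t u)
    then show ?case
      using mor_mult[OF f, of "term_class tmul S t" "term_class tmul S u"]
        mor_mult[OF g, of "term_class tmul S t" "term_class tmul S u"]
      by (simp add: free_simps)
  next
    case (Op t a \<alpha> \<beta> b)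
    then show ?case
      using mor_act[OF f, of "term_class tmul S t" a \<alpha> \<beta> b]
        mor_act[OF g, of "term_class tmul S t" a \<alpha> \<beta> b]
      by (simp add: free_simps)
  qed
  then show "f C = g C" by (simp add: t(2))
qed

primrec trm_eval :: "('t, 'g, 'm) semimod \<Rightarrow> ('s \<Rightarrow> 'm) \<Rightarrow> ('t, 'g, 's) trm \<Rightarrow> 'm" where
  "trm_eval M g (Gen s) = g s"
| "trm_eval M g Zero = \<one>\<^bsub>M\<^esub>"
| "trm_eval M g (Plus t u) = trm_eval M g t \<otimes>\<^bsub>M\<^esub> trm_eval M g u"
| "trm_eval M g (Op a \<alpha> t \<beta> b) = act M a \<alpha> (trm_eval M g t) \<beta> b"

context ternary_gamma_semimodule
begin

lemma trm_eval_closed: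
  assumes "g \<in> S \<rightarrow> carrier M"
  shows "t \<in> Term S \<Longrightarrow> trm_eval M g t \<in> carrier M"
  by (induction rule: Term.induct) (use assms in \<open>auto simp: act_closed\<close>)

text \<open>Equality of values is an equivalence relation stable under the operations, and the
  generating identities hold in \<open>M\<close> because they are its axioms.\<close>

lemma trm_eval_cong:
  assumes "g \<in> S \<rightarrow> carrier M"
  shows "(t, u) \<in> term_eq tmul S \<Longrightarrow> trm_eval M g t = trm_eval M g u"
  by (induction rule: term_eq.induct)
    (simp_all add: trm_eval_closed[OF assms] act_closed m_ac act_add1 act_add2 act_add3
      act_add4 act_add5 act_zero1 act_zero2 act_zero3 act_zero4 act_zero5 act_compat)

text \<open>Existence half of the universal property of F(S): evaluation of terms respects
  \<open>term_eq\<close> and hence descends to classes.\<close>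

lemma free_lift:
  assumes g: "g \<in> S \<rightarrow> carrier M"
  shows "\<exists>f \<in> mor (free_semimod tmul S) M. \<forall>s \<in> S. f (term_class tmul S (Gen s)) = g s"
proof -
  \<comment> \<open>The representative is arbitrary; \<open>trm_eval_cong\<close> makes the value
    independent of it.\<close>
  define f where "f = (\<lambda>C \<in> carrier (free_semimod tmul S). trm_eval M g (SOME t. t \<in> C))"
  have f_class: "f (term_class tmul S t) = trm_eval M g t" if "t \<in> Term S" for t
  proof -
    have "(SOME u. u \<in> term_class tmul S t) \<in> term_class tmul S t"
      by (rule someI[of _ t]) (simp add: term_eq.refl that)
    then have "trm_eval M g (SOME u. u \<in> term_class tmul S t) = trm_eval M g t"
      by (auto dest: trm_eval_cong[OF g])
    then show ?thesis
      using that by (simp add: f_def carrier_free)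
  qed
  have "f \<in> mor (free_semimod tmul S) M"
  proof (rule morI)
    show "f \<in> extensional (carrier (free_semimod tmul S))"
      by (simp add: f_def)
  qed (auto simp: free_simps f_class Term.intros trm_eval_closed[OF g])
  then show ?thesis
    by (rule bexI[rotated]) (simp add: f_class Term.Gen)
qed

end

theorem proposition9p6:
  fixes tmul :: "'t::comm_monoid_add \<Rightarrow> 'g::comm_monoid_add \<Rightarrow> 't \<Rightarrow> 'g \<Rightarrow> 't \<Rightarrow> 't"
    and S :: "'s set"
  assumes "ternary_gamma_semiring tmul"
  shows "projective TYPE('u) tmul (free_semimod tmul S)"
  unfolding projective_def
proof (intro conjI allI impI ballI)
  show F: "ternary_gamma_semimodule tmul (free_semimod tmul S)"
    by (rule free_semimodule) fact
  fix X Y :: "('t, 'g, 'u) semimod" and e f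
  assume epi: "regular_epi tmul X Y e" and f: "f \<in> mor (free_semimod tmul S) Y"
  interpret X: ternary_gamma_semimodule tmul X
    using epi by (simp add: regular_epi_def)
  have e: "e \<in> mor X Y"
    using epi by (auto simp: regular_epi_def coequalizer_def)
  define g where "g = (\<lambda>s. inv_into (carrier X) e (f (term_class tmul S (Gen s))))"
  have "f (term_class tmul S (Gen s)) \<in> e ` carrier X" if "s \<in> S" for s
    using that by (simp add: regular_epi_surj[OF epi] mor_closed[OF f] carrier_free Term.Gen)
  then have g: "g \<in> S \<rightarrow> carrier X" "\<And>s. s \<in> S \<Longrightarrow> e (g s) = f (term_class tmul S (Gen s))"
    by (auto simp: g_def inv_into_into f_inv_into_f)
  obtain f' where f': "f' \<in> mor (free_semimod tmul S) X"
    "\<And>s. s \<in> S \<Longrightarrow> f' (term_class tmul S (Gen s)) = g s"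
    using X.free_lift[OF g(1)] by blast
  \<comment> \<open>Both sides are morphisms out of F(S), so it suffices to compare them on
    generators, where \<open>g\<close> picks preimages under \<open>e\<close>.\<close>
  have "compose (carrier (free_semimod tmul S)) e f' = f"
    by (rule mor_free_eqI[OF mor_compose[OF F f'(1) e] f])
      (simp add: compose_def carrier_free Term.Gen f'(2) g(2))
  with f'(1) show "\<exists>f' \<in> mor (free_semimod tmul S) X.
    compose (carrier (free_semimod tmul S)) e f' = f" by blast
qed

end
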